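(* Let $X$ be a finite-dimensional Banach space. Then the union of the spaces $\mathcal{N}'(E)$, where $E$ ranges over all direction sets in $X$, is $d$-dense in $\mathcal{N}'(X)$.
   Context: $\mathcal{N}(X)$ is the set of equivalent norms on $X$; $\mathcal{N}'(X)=\mathcal{N}(X)/\sim$, where $p\sim q$ iff $q=cp$ for some $c>0$; a bar denotes the class of a norm. For $p,q\in\mathcal{N}(X)$, $d(\overline p,\overline q)=\log(u/l)$, where $u\ge l>0$ are the optimal constants with $l\,p\le q\le u\,p$ on $X$; this is a metric on $\mathcal{N}'(X)$. A direction set in $(X,\|\cdot\|)$ is a finite subset $E\subset S_X$ of the unit sphere with $E=-E$ and $\operatorname{conv}(E)$ having nonempty interior. $\operatorname{Dir}(E)=\{cx:c>0,x\in E\}$. $\mathcal{N}(E)$ is the set of $p\in\mathcal{N}(X)$ such that every extreme point of the unit ball $B_p=\{x:p(x)\le1\}$ lies in $\operatorname{Dir}(E)$, and $\mathcal{N}'(E)=\mathcal{N}(E)/\sim\ \subset\mathcal{N}'(X)$. *)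

theory Defs
  imports "HOL-Analysis.Analysis"
begin

definition is_norm :: "('a::real_vector \<Rightarrow> real) \<Rightarrow> bool" where
  "is_norm p \<longleftrightarrow>
     (\<forall>x. 0 \<le> p x) \<and> (\<forall>x. p x = 0 \<longleftrightarrow> x = 0) \<and>
     (\<forall>c x. p (c *\<^sub>R x) = \<bar>c\<bar> * p x) \<and> (\<forall>x y. p (x + y) \<le> p x + p y)"

text \<open>The Banach space is the type \<open>'a\<close> with its norm \<^const>\<open>norm\<close>; the other norms on it are
  functions \<open>'a \<Rightarrow> real\<close>.\<close>

definition equiv_norms :: "('a::real_normed_vector \<Rightarrow> real) set" where
  "equiv_norms =
     {p. is_norm p \<and> (\<exists>a>0. \<exists>b>0. \<forall>x. a * norm x \<le> p x \<and> p x \<le> b * norm x)}"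

definition norm_sim :: "(('a::real_normed_vector \<Rightarrow> real) \<times> ('a \<Rightarrow> real)) set" where
  "norm_sim =
     {(p, q). p \<in> equiv_norms \<and> q \<in> equiv_norms \<and> (\<exists>c>0. \<forall>x. q x = c * p x)}"

definition norm_classes :: "('a::real_normed_vector \<Rightarrow> real) set set" where
  "norm_classes = equiv_norms // norm_sim"

definition upper_const :: "('a \<Rightarrow> real) \<Rightarrow> ('a \<Rightarrow> real) \<Rightarrow> real" where
  "upper_const p q = Inf {u. \<forall>x. q x \<le> u * p x}"

definition lower_const :: "('a \<Rightarrow> real) \<Rightarrow> ('a \<Rightarrow> real) \<Rightarrow> real" where
  "lower_const p q = Sup {l. \<forall>x. l * p x \<le> q x}"

definition norm_dist :: "('a \<Rightarrow> real) \<Rightarrow> ('a \<Rightarrow> real) \<Rightarrow> real" where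
  "norm_dist p q = ln (upper_const p q / lower_const p q)"

text \<open>The value does not depend on the representatives, see \<open>class_dist_class\<close> below.
  The value 0 outside \<^const>\<open>norm_classes\<close> is there because \<^locale>\<open>Metric_space\<close> asks for
  nonnegativity and symmetry on the whole type.\<close>

definition class_dist ::
  "('a::real_normed_vector \<Rightarrow> real) set \<Rightarrow> ('a \<Rightarrow> real) set \<Rightarrow> real" where
  "class_dist P Q =
     (if P \<in> norm_classes \<and> Q \<in> norm_classes
      then THE r. \<exists>p\<in>P. \<exists>q\<in>Q. r = norm_dist p q else 0)"

definition direction_set :: "'a::real_normed_vector set \<Rightarrow> bool" where
  "direction_set E \<longleftrightarrow>
     finite E \<and> E \<subseteq> sphere 0 1 \<and> E = uminus ` E \<and> interior (convex hull E) \<noteq> {}"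

definition Dir :: "'a::real_vector set \<Rightarrow> 'a set" where
  "Dir E = {c *\<^sub>R x | c x. 0 < c \<and> x \<in> E}"

definition dir_norms :: "'a::real_normed_vector set \<Rightarrow> ('a \<Rightarrow> real) set" where
  "dir_norms E =
     {p \<in> equiv_norms. \<forall>x. x extreme_point_of {y. p y \<le> 1} \<longrightarrow> x \<in> Dir E}"

text \<open>\<^const>\<open>dir_norms\<close> is closed under \<^const>\<open>norm_sim\<close>, see \<open>dir_norms_sim\<close> below, so these
  classes are contained in \<^term>\<open>dir_norms E\<close>.\<close>

definition dir_norm_classes :: "'a::real_normed_vector set \<Rightarrow> ('a \<Rightarrow> real) set set" where
  "dir_norm_classes E = dir_norms E // norm_sim"

lemma equiv_norm_sim: "equiv equiv_norms (norm_sim :: (('a::real_normed_vector \<Rightarrow> real) \<times> _) set)"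
proof (rule equivI)
  show "norm_sim \<subseteq> equiv_norms \<times> (equiv_norms :: ('a \<Rightarrow> real) set)"
    by (auto simp: norm_sim_def)
  show "refl_on equiv_norms (norm_sim :: (('a \<Rightarrow> real) \<times> _) set)"
    by (auto simp: refl_on_def norm_sim_def intro: exI[of _ 1])
  show "sym (norm_sim :: (('a \<Rightarrow> real) \<times> _) set)"
  proof (rule symI)
    fix p q :: "'a \<Rightarrow> real"
    assume "(p, q) \<in> norm_sim"
    then obtain c where "p \<in> equiv_norms" "q \<in> equiv_norms" "c > 0" "\<forall>x. q x = c * p x"
      by (auto simp: norm_sim_def)
    then show "(q, p) \<in> norm_sim"
      by (auto simp: norm_sim_def intro!: exI[of _ "1/c"])
  qed
  show "trans (norm_sim :: (('a \<Rightarrow> real) \<times> _) set)"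
  proof (rule transI)
    fix p q r :: "'a \<Rightarrow> real"
    assume "(p, q) \<in> norm_sim" "(q, r) \<in> norm_sim"
    then obtain c c' where "p \<in> equiv_norms" "r \<in> equiv_norms" "c > 0" "c' > 0"
      "\<forall>x. q x = c * p x" "\<forall>x. r x = c' * q x"
      by (auto simp: norm_sim_def)
    then show "(p, r) \<in> norm_sim"
      by (auto simp: norm_sim_def intro!: exI[of _ "c' * c"])
  qed
qed

lemma equiv_norms_pos: "p \<in> equiv_norms \<Longrightarrow> x \<noteq> 0 \<Longrightarrow> 0 < p x"
  by (auto simp: equiv_norms_def is_norm_def less_le)

lemma equiv_norms_0: "p \<in> equiv_norms \<Longrightarrow> p 0 = 0"
  by (auto simp: equiv_norms_def is_norm_def)

context
  fixes e :: "'a::real_normed_vector"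
  assumes e: "e \<noteq> 0"
begin

lemma upper_set:
  fixes p q :: "'a \<Rightarrow> real"
  assumes p: "p \<in> equiv_norms" and q: "q \<in> equiv_norms"
  shows "{u. \<forall>x. q x \<le> u * p x} \<noteq> {}" "bdd_below {u. \<forall>x. q x \<le> u * p x}"
proof -
  obtain a where a: "a > 0" "\<And>x. a * norm x \<le> p x"
    using p by (auto simp: equiv_norms_def)
  obtain b where b: "b > 0" "\<And>x. q x \<le> b * norm x"
    using q by (auto simp: equiv_norms_def)
  have "q x \<le> b / a * p x" for x
  proof -
    have "q x \<le> b / a * (a * norm x)" using a(1) b(2)[of x] by simp
    also have "\<dots> \<le> b / a * p x" using a b by (intro mult_left_mono) auto
    finally show ?thesis .
  qed
  then show "{u. \<forall>x. q x \<le> u * p x} \<noteq> {}" by blast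
  have "0 \<le> u" if "\<forall>x. q x \<le> u * p x" for u
  proof -
    have "0 < u * p e" using that e equiv_norms_pos[OF q e] by (meson less_le_trans)
    then show ?thesis using equiv_norms_pos[OF p e] by (simp add: zero_less_mult_iff)
  qed
  then show "bdd_below {u. \<forall>x. q x \<le> u * p x}" by (intro bdd_belowI[of _ 0]) auto
qed

lemma upper_const_le:
  fixes p q :: "'a \<Rightarrow> real"
  assumes "p \<in> equiv_norms" "q \<in> equiv_norms" "\<And>x. q x \<le> u * p x"
  shows "upper_const p q \<le> u"
  unfolding upper_const_def using upper_set(2)[OF assms(1,2)] assms(3) by (auto intro: cInf_lower)

lemma upper_const_bound:
  fixes p q :: "'a \<Rightarrow> real"
  assumes p: "p \<in> equiv_norms" and q: "q \<in> equiv_norms"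
  shows "q x \<le> upper_const p q * p x"
proof (cases "x = 0")
  case True
  then show ?thesis using p q by (simp add: equiv_norms_0)
next
  case False
  have "q x / p x \<le> upper_const p q"
    unfolding upper_const_def using upper_set(1)[OF p q] equiv_norms_pos[OF p False]
    by (intro cInf_greatest) (auto simp: field_simps)
  then show ?thesis using equiv_norms_pos[OF p False] by (simp add: field_simps)
qed

lemma upper_const_pos:
  fixes p q :: "'a \<Rightarrow> real"
  assumes p: "p \<in> equiv_norms" and q: "q \<in> equiv_norms"
  shows "0 < upper_const p q"
proof -
  have "0 < upper_const p q * p e"
    using upper_const_bound[OF p q, of e] equiv_norms_pos[OF q e] by linarith
  then show ?thesis using equiv_norms_pos[OF p e] by (simp add: zero_less_mult_iff)
qed

lemma lower_const_eq:
  fixes p q :: "'a \<Rightarrow> real"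
  assumes p: "p \<in> equiv_norms" and q: "q \<in> equiv_norms"
  shows "lower_const p q = 1 / upper_const q p"
  unfolding lower_const_def
proof (rule cSup_eq_maximum)
  have U: "0 < upper_const q p" by (rule upper_const_pos[OF q p])
  show "1 / upper_const q p \<in> {l. \<forall>x. l * p x \<le> q x}"
    using upper_const_bound[OF q p] U by (auto simp: field_simps)
  fix l assume "l \<in> {l. \<forall>x. l * p x \<le> q x}"
  then have l: "\<And>x. l * p x \<le> q x" by auto
  show "l \<le> 1 / upper_const q p"
  proof (cases "l > 0")
    case True
    have "upper_const q p \<le> 1 / l"
      using l True by (intro upper_const_le[OF q p]) (auto simp: field_simps)
    then show ?thesis using True U by (simp add: field_simps)
  next
    case False
    then show ?thesis using U by (smt (verit) divide_pos_pos)
  qed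
qed

lemma optimal_consts:
  fixes p q :: "'a \<Rightarrow> real"
  assumes p: "p \<in> equiv_norms" and q: "q \<in> equiv_norms"
  shows "0 < lower_const p q" "lower_const p q \<le> upper_const p q"
    "\<And>x. lower_const p q * p x \<le> q x" "\<And>x. q x \<le> upper_const p q * p x"
proof -
  note U = upper_const_pos[OF q p]
  show "0 < lower_const p q" using lower_const_eq[OF p q] U by simp
  show l: "lower_const p q * p x \<le> q x" for x
    unfolding lower_const_eq[OF p q]
    using U upper_const_bound[OF q p, of x] by (simp add: field_simps)
  show u: "q x \<le> upper_const p q * p x" for x
    by (rule upper_const_bound[OF p q])
  have "lower_const p q * p e \<le> upper_const p q * p e" using l[of e] u[of e] by linarith
  then show "lower_const p q \<le> upper_const p q" using equiv_norms_pos[OF p e] by simp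
qed

lemma norm_dist_eq:
  fixes p q :: "'a \<Rightarrow> real"
  assumes "p \<in> equiv_norms" "q \<in> equiv_norms"
  shows "norm_dist p q = ln (upper_const p q * upper_const q p)"
  using lower_const_eq[OF assms] by (simp add: norm_dist_def)

lemma norm_dist_nonneg:
  fixes p q :: "'a \<Rightarrow> real"
  assumes "p \<in> equiv_norms" "q \<in> equiv_norms"
  shows "0 \<le> norm_dist p q"
  using optimal_consts(1,2)[OF assms] by (simp add: norm_dist_def)

lemma norm_dist_commute:
  fixes p q :: "'a \<Rightarrow> real"
  assumes "p \<in> equiv_norms" "q \<in> equiv_norms"
  shows "norm_dist p q = norm_dist q p"
  using assms by (simp add: norm_dist_eq mult.commute)

lemma norm_dist_triangle:
  fixes p q r :: "'a \<Rightarrow> real"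
  assumes p: "p \<in> equiv_norms" and q: "q \<in> equiv_norms" and r: "r \<in> equiv_norms"
  shows "norm_dist p r \<le> norm_dist p q + norm_dist q r"
proof -
  have *: "upper_const p r \<le> upper_const p q * upper_const q r"
    if p: "p \<in> equiv_norms" and q: "q \<in> equiv_norms" and r: "r \<in> equiv_norms"
    for p q r :: "'a \<Rightarrow> real"
  proof (rule upper_const_le[OF p r])
    fix x
    have "r x \<le> upper_const q r * q x" by (rule upper_const_bound[OF q r])
    also have "\<dots> \<le> upper_const q r * (upper_const p q * p x)"
      using upper_const_bound[OF p q] upper_const_pos[OF q r] by (intro mult_left_mono) auto
    finally show "r x \<le> upper_const p q * upper_const q r * p x" by (simp add: mult_ac)
  qed
  note pos = upper_const_pos[OF p q] upper_const_pos[OF q p] upper_const_pos[OF q r]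
    upper_const_pos[OF r q] upper_const_pos[OF p r] upper_const_pos[OF r p]
  have "upper_const p r * upper_const r p
      \<le> (upper_const p q * upper_const q r) * (upper_const r q * upper_const q p)"
    using *[OF p q r] *[OF r q p] pos by (intro mult_mono) auto
  also have "\<dots> = (upper_const p q * upper_const q p) * (upper_const q r * upper_const r q)"
    by (simp add: mult_ac)
  finally have "ln (upper_const p r * upper_const r p)
      \<le> ln ((upper_const p q * upper_const q p) * (upper_const q r * upper_const r q))"
    using pos by simp
  also have "\<dots> = ln (upper_const p q * upper_const q p) + ln (upper_const q r * upper_const r q)"
    using pos by (simp add: ln_mult_pos)
  finally show ?thesis using p q r by (simp add: norm_dist_eq)
qed

lemma norm_dist_0_iff:
  fixes p q :: "'a \<Rightarrow> real"
  assumes p: "p \<in> equiv_norms" and q: "q \<in> equiv_norms"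
  shows "norm_dist p q = 0 \<longleftrightarrow> (p, q) \<in> norm_sim"
proof
  assume "norm_dist p q = 0"
  then have "upper_const p q = lower_const p q"
    using optimal_consts(1,2)[OF p q] by (simp add: norm_dist_def)
  then have "q x = upper_const p q * p x" for x
    using optimal_consts(3,4)[OF p q, of x] by simp
  then show "(p, q) \<in> norm_sim"
    using p q upper_const_pos[OF p q] by (auto simp: norm_sim_def)
next
  assume "(p, q) \<in> norm_sim"
  then obtain c where c: "c > 0" "\<And>x. q x = c * p x" by (auto simp: norm_sim_def)
  have "upper_const p q \<le> c" using c by (intro upper_const_le[OF p q]) auto
  moreover have "upper_const q p \<le> 1 / c" using c by (intro upper_const_le[OF q p]) auto
  ultimately have "upper_const p q * upper_const q p \<le> c * (1 / c)"
    using upper_const_pos[OF p q] upper_const_pos[OF q p] c by (intro mult_mono) auto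
  then have "norm_dist p q \<le> 0"
    using upper_const_pos[OF p q] upper_const_pos[OF q p] c
    by (simp add: norm_dist_eq[OF p q])
  then show "norm_dist p q = 0" using norm_dist_nonneg[OF p q] by simp
qed

lemma norm_dist_cong:
  fixes p q :: "'a \<Rightarrow> real"
  assumes pp: "(p, p') \<in> norm_sim" and qq: "(q, q') \<in> norm_sim"
  shows "norm_dist p' q' = norm_dist p q"
proof -
  have mem: "p \<in> equiv_norms" "p' \<in> equiv_norms" "q \<in> equiv_norms" "q' \<in> equiv_norms"
    using assms by (auto simp: norm_sim_def)
  have 0: "norm_dist p p' = 0" "norm_dist p' p = 0" "norm_dist q q' = 0" "norm_dist q' q = 0"
    using assms mem by (simp_all add: norm_dist_0_iff norm_dist_commute)
  show ?thesis
    using norm_dist_triangle[of p' p q'] norm_dist_triangle[of p q q']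
      norm_dist_triangle[of p p' q] norm_dist_triangle[of p' q' q] mem 0 by linarith
qed

lemma class_dist_class:
  fixes p q :: "'a \<Rightarrow> real"
  assumes p: "p \<in> equiv_norms" and q: "q \<in> equiv_norms"
  shows "class_dist (norm_sim `` {p}) (norm_sim `` {q}) = norm_dist p q"
proof -
  have "(p, p) \<in> norm_sim" "(q, q) \<in> norm_sim"
    using p q equiv_norm_sim by (auto simp: equiv_def refl_on_def)
  then have "(THE r. \<exists>p'\<in>norm_sim `` {p}. \<exists>q'\<in>norm_sim `` {q}. r = norm_dist p' q')
      = norm_dist p q"
    by (intro the_equality) (auto intro: norm_dist_cong)
  then show ?thesis
    using p q by (simp add: class_dist_def norm_classes_def quotientI)
qed

lemma Metric_space_class_dist:
  "Metric_space norm_classes (class_dist :: ('a \<Rightarrow> real) set \<Rightarrow> _)"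
proof
  fix P Q :: "('a \<Rightarrow> real) set"
  show "0 \<le> class_dist P Q"
  proof (cases "P \<in> norm_classes \<and> Q \<in> norm_classes")
    case True
    then show ?thesis
      by (auto simp: norm_classes_def class_dist_class norm_dist_nonneg elim!: quotientE)
  qed (auto simp: class_dist_def)
  show "class_dist P Q = class_dist Q P"
  proof (cases "P \<in> norm_classes \<and> Q \<in> norm_classes")
    case True
    then show ?thesis
      by (auto simp: norm_classes_def class_dist_class norm_dist_commute elim!: quotientE)
  qed (auto simp: class_dist_def)
next
  fix P Q :: "('a \<Rightarrow> real) set"
  assume "P \<in> norm_classes" "Q \<in> norm_classes"
  then obtain p q where "p \<in> equiv_norms" "P = norm_sim `` {p}" "q \<in> equiv_norms" "Q = norm_sim `` {q}"
    by (auto simp: norm_classes_def elim!: quotientE)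
  then show "class_dist P Q = 0 \<longleftrightarrow> P = Q"
    by (simp only: class_dist_class norm_dist_0_iff eq_equiv_class_iff[OF equiv_norm_sim])
next
  fix P Q R :: "('a \<Rightarrow> real) set"
  assume "P \<in> norm_classes" "Q \<in> norm_classes" "R \<in> norm_classes"
  then show "class_dist P R \<le> class_dist P Q + class_dist Q R"
    by (auto simp: norm_classes_def class_dist_class norm_dist_triangle elim!: quotientE)
qed

end

lemma dir_norms_sim:
  assumes p: "p \<in> dir_norms E" and pq: "(p, q) \<in> norm_sim"
  shows "q \<in> dir_norms E"
proof -
  obtain c where c: "c > 0" "\<And>x. q x = c * p x" and q: "q \<in> equiv_norms"
    using pq by (auto simp: norm_sim_def)
  have hom: "p (c *\<^sub>R x) = c * p x" for x
    using p c(1) by (auto simp: dir_norms_def equiv_norms_def is_norm_def)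
  have ball: "{y. p y \<le> 1} = (*\<^sub>R) c ` {y. q y \<le> 1}"
  proof (intro equalityI subsetI)
    fix y assume "y \<in> {y. p y \<le> 1}"
    then have "y = c *\<^sub>R ((1/c) *\<^sub>R y)" "q ((1/c) *\<^sub>R y) \<le> 1"
      using c hom[of "(1/c) *\<^sub>R y"] by auto
    then show "y \<in> (*\<^sub>R) c ` {y. q y \<le> 1}" by blast
  qed (use c hom in auto)
  have "x \<in> Dir E" if "x extreme_point_of {y. q y \<le> 1}" for x
  proof -
    have "linear ((*\<^sub>R) c :: 'a \<Rightarrow> 'a)" "inj ((*\<^sub>R) c :: 'a \<Rightarrow> 'a)"
      using c(1) by (auto simp: inj_on_def intro: linearI simp: algebra_simps)
    then have "c *\<^sub>R x extreme_point_of {y. p y \<le> 1}"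
      unfolding ball using that
      by (auto simp: extreme_point_of_def open_segment_linear_image dest: injD)
    then obtain d z where "d > 0" "z \<in> E" "c *\<^sub>R x = d *\<^sub>R z"
      using p by (auto simp: dir_norms_def Dir_def)
    then have "(1 / c) *\<^sub>R (c *\<^sub>R x) = (1 / c) *\<^sub>R (d *\<^sub>R z)" by (simp only:)
    then have "x = (d / c) *\<^sub>R z" using c(1) by simp
    moreover have "d / c > 0" using c(1) \<open>d > 0\<close> by simp
    ultimately show ?thesis using \<open>z \<in> E\<close> unfolding Dir_def by blast
  qed
  then show ?thesis using q by (auto simp: dir_norms_def)
qed

lemma dir_norm_classes_subset: "dir_norm_classes E \<subseteq> norm_classes"
  by (auto simp: dir_norm_classes_def norm_classes_def dir_norms_def quotient_def)

end

theory Submission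
  imports Defs
begin

text \<open>
  Every norm \<open>p\<close> is within an arbitrarily small distance of a norm whose unit ball is a
  polytope, and the extreme points of a polytope point in only finitely many directions.

  In detail, let \<open>0 < \<delta> < 1\<close>. The unit sphere of \<open>p\<close> is compact because the dimension is finite
  (\<open>compact_cball_Int_span\<close>), so it has a finite symmetric \<open>\<delta>\<close>-net \<open>F\<close>. The polytope
  \<open>C = conv F\<close> lies in the unit ball of \<open>p\<close>, and it contains the ball of radius \<open>1 - \<delta>\<close>: approximate a
  point by a multiple of a point of \<open>F\<close>, then approximate the error in the same way, and so on; the
  multiples form a geometric series of sum \<open>1 / (1 - \<delta>)\<close> (\<open>norm_ball_subset_if_approximated\<close>).
  Hence the gauge \<open>q\<close> of \<open>C\<close> is a norm with unit ball \<open>C\<close> and \<open>p \<le> q \<le> p / (1 - \<delta>)\<close>,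
  so the classes of \<open>p\<close> and \<open>q\<close> have distance at most \<open>- ln (1 - \<delta>)\<close>.

  The extreme points of \<open>C\<close> belong to \<open>F\<close>. Radial projection of \<open>F\<close> to the unit sphere of the space
  gives a direction set \<open>E\<close> with \<open>F \<subseteq> Dir E\<close>, and therefore \<open>q\<close> belongs to \<open>dir_norms E\<close>.
\<close>

section \<open>Compactness in finite-dimensional normed spaces\<close>

lemma closed_if_compact_cball_Int:
  fixes S :: "'a::real_normed_vector set"
  assumes "\<And>r. compact (cball 0 r \<inter> S)"
  shows "closed S"
  unfolding closed_sequential_limits
proof (intro allI impI, elim conjE)
  fix x :: "nat \<Rightarrow> 'a" and l
  assume x: "\<forall>n. x n \<in> S" and l: "x \<longlonglongrightarrow> l"
  obtain r where r: "\<And>n. norm (x n) \<le> r"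
    using convergent_imp_bounded[OF l] by (auto simp: bounded_iff)
  have "closed (cball 0 r \<inter> S)"
    using assms by (rule compact_imp_closed)
  moreover have "\<forall>n. x n \<in> cball 0 r \<inter> S"
    using x r by auto
  ultimately have "l \<in> cball 0 r \<inter> S"
    using l unfolding closed_sequential_limits by blast
  then show "l \<in> S" by blast
qed

text \<open>
  Induction on the spanning set. If \<open>b\<close> is outside the closed subspace \<open>span B\<close>, then it has a
  positive distance \<open>d\<close> from it, and this bounds the coefficient \<open>t\<close> in a vector \<open>t b + y\<close> with
  \<open>y \<in> span B\<close> by its norm divided by \<open>d\<close>. A ball in the larger span is thus a closed part of the
  image of a compact product.
\<close>

lemma compact_cball_Int_span:
  fixes B :: "'a::real_normed_vector set"
  assumes "finite B"
  shows "compact (cball 0 r \<inter> span B)"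
  using assms
proof (induction B arbitrary: r rule: finite_induct)
  case empty
  have "cball 0 r \<inter> span {} = (if 0 \<le> r then {0::'a} else {})" by auto
  then show ?case by simp
next
  case (insert b B)
  show ?case
  proof (cases "b \<in> span B")
    case True
    then show ?thesis using insert.IH by (simp add: span_redundant)
  next
    case False
    define d where "d = infdist b (span B)"
    have "closed (span B)"
      using insert.IH by (rule closed_if_compact_cball_Int)
    then have d: "0 < d"
      unfolding d_def using False span_zero by (intro infdist_pos_not_in_closed) auto
    have coeff: "\<bar>t\<bar> * d \<le> norm (t *\<^sub>R b + y)" if "y \<in> span B" for t y
    proof (cases "t = 0")
      case False
      have "- (y /\<^sub>R t) \<in> span B" using that by (intro span_neg span_scale)
      then have "d \<le> dist b (- (y /\<^sub>R t))" unfolding d_def by (rule infdist_le)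
      then have "\<bar>t\<bar> * d \<le> \<bar>t\<bar> * norm (b + y /\<^sub>R t)"
        by (intro mult_left_mono) (auto simp: dist_norm)
      also have "\<dots> = norm (t *\<^sub>R (b + y /\<^sub>R t))" by simp
      also have "t *\<^sub>R (b + y /\<^sub>R t) = t *\<^sub>R b + y"
        using False by (simp add: scaleR_right_distrib)
      finally show ?thesis .
    qed simp
    define R where "R = r + r / d * norm b"
    define K where "K = (\<lambda>(t, y). t *\<^sub>R b + y) ` ({- (r / d)..r / d} \<times> (cball 0 R \<inter> span B))"
    have "compact K"
      unfolding K_def
      by (intro compact_continuous_image compact_Times insert.IH compact_Icc)
        (auto simp: case_prod_unfold intro!: continuous_intros)
    moreover have "cball 0 r \<inter> span (insert b B) = cball 0 r \<inter> K"
    proof (intro equalityI subsetI)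
      fix x assume x: "x \<in> cball 0 r \<inter> span (insert b B)"
      then obtain t where t: "x - t *\<^sub>R b \<in> span B" by (auto simp: span_breakdown_eq)
      then have "\<bar>t\<bar> * d \<le> norm x" using coeff[OF t, of t] by simp
      also have "\<dots> \<le> r" using x by simp
      finally have t_le: "\<bar>t\<bar> \<le> r / d" using d by (simp add: field_simps)
      have "norm (x - t *\<^sub>R b) \<le> norm x + \<bar>t\<bar> * norm b"
        using norm_triangle_ineq4[of x "t *\<^sub>R b"] by simp
      also have "\<dots> \<le> R"
        unfolding R_def using x t_le by (intro add_mono mult_right_mono) auto
      finally have "(t, x - t *\<^sub>R b) \<in> {- (r / d)..r / d} \<times> (cball 0 R \<inter> span B)"
        using t t_le by auto
      then have "x \<in> K" unfolding K_def by (intro image_eqI) auto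
      then show "x \<in> cball 0 r \<inter> K" using x by blast
    next
      fix x assume x: "x \<in> cball 0 r \<inter> K"
      then obtain t y where "x = t *\<^sub>R b + y" "y \<in> span B" unfolding K_def by auto
      then have "x - t *\<^sub>R b \<in> span B" by simp
      then have "x \<in> span (insert b B)" using span_breakdown_eq by blast
      then show "x \<in> cball 0 r \<inter> span (insert b B)" using x by blast
    qed
    ultimately show ?thesis by (simp add: closed_Int_compact)
  qed
qed

section \<open>Norms and their balls\<close>

lemma is_normD:
  assumes "is_norm p"
  shows "0 \<le> p x" "p x = 0 \<longleftrightarrow> x = 0" "p (c *\<^sub>R x) = \<bar>c\<bar> * p x" "p (x + y) \<le> p x + p y"
    "p 0 = 0" "p (- x) = p x"
proof -
  show *: "0 \<le> p x" "p x = 0 \<longleftrightarrow> x = 0" "p (c *\<^sub>R x) = \<bar>c\<bar> * p x" "p (x + y) \<le> p x + p y" for c x y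
    using assms by (auto simp: is_norm_def)
  show "p 0 = 0" using *(2) by blast
  show "p (- x) = p x" using *(3)[of "-1" x] by simp
qed

lemma equiv_norms_continuous:
  assumes "p \<in> equiv_norms"
  shows "continuous_on UNIV p"
proof -
  have p: "is_norm p" using assms by (simp add: equiv_norms_def)
  obtain b where b: "b > 0" "\<And>x. p x \<le> b * norm x"
    using assms by (auto simp: equiv_norms_def)
  have diff: "p x - p y \<le> b * dist x y" for x y
    using is_normD(4)[OF p, of "x - y" y] b(2)[of "x - y"] by (simp add: dist_norm)
  have "dist (p x) (p y) \<le> b * dist x y" for x y
    using diff[of x y] diff[of y x] by (simp add: dist_real_def dist_commute)
  then have "b-lipschitz_on UNIV p" using b(1) by (intro lipschitz_onI) auto
  then show ?thesis by (rule lipschitz_on_continuous_on)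
qed

lemma convex_combine_multiples:
  assumes "convex C" "c \<in> C" "c' \<in> C" "0 \<le> s" "0 \<le> t"
  obtains c'' where "c'' \<in> C" "s *\<^sub>R c + t *\<^sub>R c' = (s + t) *\<^sub>R c''"
proof (cases "s + t = 0")
  case True
  then show ?thesis using assms that[of c] by (auto simp: add_nonneg_eq_0_iff)
next
  case False
  then have "(s / (s + t)) *\<^sub>R c + (t / (s + t)) *\<^sub>R c' \<in> C"
    using assms by (intro convexD) (auto simp: add_divide_distrib[symmetric])
  then show ?thesis
    using that False by (fastforce simp: scaleR_right_distrib)
qed

text \<open>
  The hypothesis \<open>approx\<close> says that, up to scaling, every point of the unit sphere of \<open>p\<close> is
  within \<open>\<delta>\<close> of a point of \<open>C\<close>. Applying it again to the error \<open>x - p x *\<^sub>R c\<close>, and repeating this,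
  leaves an error of at most \<open>\<delta>\<close> to the power \<open>n\<close> after \<open>n\<close> steps. The accumulated approximation is
  a combination of points of \<open>C\<close> with coefficients of sum at most \<open>p x\<close> times the sum
  \<open>1 / (1 - \<delta>)\<close> of the geometric series.
\<close>

lemma norm_ball_subset_if_approximated:
  assumes p: "p \<in> equiv_norms"
    and C: "closed C" "convex C" "0 \<in> C"
    and \<delta>: "0 \<le> \<delta>" "\<delta> < 1"
    and approx: "\<And>x. \<exists>c\<in>C. p (x - p x *\<^sub>R c) \<le> \<delta> * p x"
    and x: "p x \<le> 1 - \<delta>"
  shows "x \<in> C"
proof -
  have is_norm_p: "is_norm p" using p by (simp add: equiv_norms_def)
  note [simp] = is_normD(1)[OF is_norm_p]
  have "\<exists>c\<in>C. p (x - (p x / (1 - \<delta>)) *\<^sub>R c) \<le> \<delta> ^ n * p x" for n x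
  proof (induction n arbitrary: x)
    case 0
    then show ?case using C(3) by (intro bexI[of _ 0]) auto
  next
    case (Suc n)
    obtain c where c: "c \<in> C" "p (x - p x *\<^sub>R c) \<le> \<delta> * p x" using approx by blast
    define y where "y = x - p x *\<^sub>R c"
    obtain c' where c': "c' \<in> C" "p (y - (p y / (1 - \<delta>)) *\<^sub>R c') \<le> \<delta> ^ n * p y"
      using Suc.IH by blast
    \<comment> \<open>With this \<open>t\<close>, the coefficients \<open>p x\<close> and \<open>t\<close> add up to \<open>p x / (1 - \<delta>)\<close>.\<close>
    define t where "t = \<delta> * p x / (1 - \<delta>)"
    have y: "p y \<le> \<delta> * p x" using c(2) by (simp add: y_def)
    have t: "0 \<le> p y / (1 - \<delta>)" "p y / (1 - \<delta>) \<le> t"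
      using \<delta> y unfolding t_def by (auto intro: divide_right_mono)
    \<comment> \<open>Adding a multiple of \<open>0 \<in> C\<close> raises the coefficient of \<open>c'\<close> to exactly \<open>t\<close>.\<close>
    obtain c1 where c1: "c1 \<in> C"
      "(p y / (1 - \<delta>)) *\<^sub>R c' + (t - p y / (1 - \<delta>)) *\<^sub>R 0 = (p y / (1 - \<delta>) + (t - p y / (1 - \<delta>))) *\<^sub>R c1"
      using convex_combine_multiples[OF C(2) c'(1) C(3) t(1)] t(2) by (metis diff_ge_0_iff_ge)
    obtain c2 where c2: "c2 \<in> C" "p x *\<^sub>R c + t *\<^sub>R c1 = (p x + t) *\<^sub>R c2"
      using convex_combine_multiples[OF C(2) c(1) c1(1), of "p x" t] t by auto
    have "p x + t = p x / (1 - \<delta>)" using \<delta> by (simp add: t_def field_simps)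
    then have "x - (p x / (1 - \<delta>)) *\<^sub>R c2 = y - (p y / (1 - \<delta>)) *\<^sub>R c'"
      using c1(2) c2(2) by (simp add: y_def algebra_simps)
    then have "p (x - (p x / (1 - \<delta>)) *\<^sub>R c2) \<le> \<delta> ^ n * p y" using c'(2) by simp
    also have "\<dots> \<le> \<delta> ^ n * (\<delta> * p x)" using y \<delta> by (intro mult_left_mono) auto
    finally show ?case using c2(1) by (auto simp: mult_ac)
  qed
  then obtain c where c: "\<And>n. c n \<in> C" "\<And>n. p (x - (p x / (1 - \<delta>)) *\<^sub>R c n) \<le> \<delta> ^ n * p x"
    by metis
  obtain a where a: "a > 0" "\<And>x. a * norm x \<le> p x" using p by (auto simp: equiv_norms_def)
  have "(\<lambda>n. (p x / (1 - \<delta>)) *\<^sub>R c n) \<longlonglongrightarrow> x"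
  proof (rule LIM_zero_cancel, rule Lim_null_comparison)
    show "\<forall>\<^sub>F n in sequentially. norm ((p x / (1 - \<delta>)) *\<^sub>R c n - x) \<le> \<delta> ^ n * p x / a"
    proof (intro always_eventually allI)
      fix n
      have "a * norm ((p x / (1 - \<delta>)) *\<^sub>R c n - x) \<le> \<delta> ^ n * p x"
        using a(2)[of "x - (p x / (1 - \<delta>)) *\<^sub>R c n"] c(2)[of n] by (simp add: norm_minus_commute)
      then show "norm ((p x / (1 - \<delta>)) *\<^sub>R c n - x) \<le> \<delta> ^ n * p x / a"
        using a(1) by (simp add: field_simps)
    qed
    have "(\<lambda>n. \<delta> ^ n) \<longlonglongrightarrow> 0" using \<delta> by (intro LIMSEQ_realpow_zero)
    then show "(\<lambda>n. \<delta> ^ n * p x / a) \<longlonglongrightarrow> 0"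
      by (intro tendsto_divide_zero tendsto_mult_left_zero)
  qed
  moreover have "(p x / (1 - \<delta>)) *\<^sub>R c n \<in> C" for n
  proof -
    have "(p x / (1 - \<delta>)) *\<^sub>R c n + (1 - p x / (1 - \<delta>)) *\<^sub>R 0 \<in> C"
      using x \<delta> by (intro convexD[OF C(2) c(1) C(3)]) auto
    then show ?thesis by simp
  qed
  ultimately show ?thesis
    by (rule closed_sequentially[OF C(1), rotated])
qed

section \<open>Norms with a prescribed unit ball\<close>

text \<open>
  The Minkowski functional of \<open>C\<close>. It is meaningful for absorbing \<open>C\<close> only: otherwise the set
  may be empty and its infimum is then arbitrary.
\<close>

definition gauge_of :: "'a::real_vector set \<Rightarrow> 'a \<Rightarrow> real" where
  "gauge_of C x = Inf {t. 0 < t \<and> x /\<^sub>R t \<in> C}"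

text \<open>
  A closed convex symmetric set \<open>C\<close> squeezed between two balls of a norm \<open>p\<close>. The inner ball makes
  the gauge of \<open>C\<close> finite, the outer ball makes it definite, and both together compare it
  with \<open>p\<close>.
\<close>

locale norm_body =
  fixes C :: "'a::real_normed_vector set" and p :: "'a \<Rightarrow> real" and r :: real
  assumes p: "p \<in> equiv_norms"
    and C: "closed C" "convex C" "C = uminus ` C"
    and r: "0 < r"
    and inner: "{x. p x \<le> r} \<subseteq> C"
    and outer: "C \<subseteq> {x. p x \<le> 1}"
begin

lemma is_norm_p: "is_norm p"
  using p by (simp add: equiv_norms_def)

lemma zero_mem: "0 \<in> C"
  using inner r is_normD(5)[OF is_norm_p] by auto

text \<open>
  The infimum is attained since \<open>C\<close> is closed. All properties of the gauge below are read
  off from this equivalence.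
\<close>

lemma gauge_of_le_iff:
  assumes t: "0 < t"
  shows "gauge_of C x \<le> t \<longleftrightarrow> x /\<^sub>R t \<in> C"
proof
  have bdd: "bdd_below {t. 0 < t \<and> x /\<^sub>R t \<in> C}" by (rule bdd_belowI[of _ 0]) auto
  {
    assume "x /\<^sub>R t \<in> C"
    then show "gauge_of C x \<le> t"
      unfolding gauge_of_def using t bdd by (intro cInf_lower) auto
  }
  assume le: "gauge_of C x \<le> t"
  \<comment> \<open>Adding 1 makes \<open>s\<close> positive also for \<open>x = 0\<close>.\<close>
  define s where "s = p x / r + 1"
  have s: "0 < s" using r is_normD(1)[OF is_norm_p, of x] by (simp add: s_def add_nonneg_pos)
  have "p (x /\<^sub>R s) \<le> r"
    using s r by (simp add: is_normD(3)[OF is_norm_p] field_simps) (simp add: s_def field_simps)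
  then have ne: "{t. 0 < t \<and> x /\<^sub>R t \<in> C} \<noteq> {}" using s inner by blast
  have "x /\<^sub>R (t + 1 / Suc n) \<in> C" for n
  proof -
    have "Inf {t. 0 < t \<and> x /\<^sub>R t \<in> C} < t + 1 / Suc n"
      using le unfolding gauge_of_def by (simp add: add_strict_increasing2 order.strict_trans1)
    then obtain u where u: "0 < u" "x /\<^sub>R u \<in> C" "u < t + 1 / Suc n"
      using cInf_lessD[OF ne] by blast
    define v where "v = t + 1 / Suc n"
    \<comment> \<open>\<open>C\<close> is star-shaped about 0, so scaling down by \<open>u / v < 1\<close> stays in it.\<close>
    have "(u / v) *\<^sub>R (x /\<^sub>R u) + (1 - u / v) *\<^sub>R 0 \<in> C"
      using u unfolding v_def[symmetric] by (intro convexD[OF C(2) _ zero_mem]) auto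
    then show ?thesis using u unfolding v_def[symmetric] by (simp add: field_simps)
  qed
  moreover have "(\<lambda>n. x /\<^sub>R (t + 1 / Suc n)) \<longlonglongrightarrow> x /\<^sub>R (t + 0)"
    using t by (intro tendsto_intros LIMSEQ_Suc[OF lim_const_over_n]) auto
  ultimately show "x /\<^sub>R t \<in> C"
    using C(1) unfolding closed_sequential_limits by fastforce
qed

lemma gauge_of_bounds: "p x \<le> gauge_of C x" "gauge_of C x \<le> p x / r"
proof -
  have px: "0 \<le> p x" by (rule is_normD(1)[OF is_norm_p])
  have bound: "p x \<le> t" if "0 < t" "gauge_of C x \<le> t" for t
  proof -
    have "p (x /\<^sub>R t) \<le> 1" using that gauge_of_le_iff outer by blast
    then show ?thesis using that by (simp add: is_normD(3)[OF is_norm_p] field_simps)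
  qed
  have nonneg: "0 \<le> gauge_of C x"
  proof (rule ccontr)
    assume neg: "\<not> 0 \<le> gauge_of C x"
    show False
    proof (cases "x = 0")
      case True
      then have "{t. 0 < t \<and> x /\<^sub>R t \<in> C} = {0<..}" using zero_mem by auto
      then show False using neg by (simp add: gauge_of_def)
    next
      case False
      then have "0 < p x" by (rule equiv_norms_pos[OF p])
      then show False using bound[of "p x / 2"] neg by auto
    qed
  qed
  show "p x \<le> gauge_of C x"
  proof (rule field_le_epsilon)
    fix e :: real assume "0 < e"
    then show "p x \<le> gauge_of C x + e" using bound[of "gauge_of C x + e"] nonneg by auto
  qed
  show "gauge_of C x \<le> p x / r"
  proof (rule field_le_epsilon)
    fix e :: real assume e: "0 < e"
    define t where "t = p x / r + e"
    have t: "0 < t" using e r px by (simp add: t_def add_nonneg_pos)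
    have "p x \<le> r * t" using e r by (simp add: t_def field_simps)
    then have "p (x /\<^sub>R t) \<le> r" using t by (simp add: is_normD(3)[OF is_norm_p] field_simps)
    then show "gauge_of C x \<le> p x / r + e"
      using t gauge_of_le_iff inner unfolding t_def[symmetric] by blast
  qed
qed

lemma gauge_of_nonneg: "0 \<le> gauge_of C x"
  using gauge_of_bounds(1) is_normD(1)[OF is_norm_p] by (rule order_trans[rotated])

lemma gauge_of_scaleR: "gauge_of C (c *\<^sub>R x) = \<bar>c\<bar> * gauge_of C x"
proof -
  have sym: "- y \<in> C \<longleftrightarrow> y \<in> C" for y using C(3) by (metis image_eqI minus_minus)
  have le: "gauge_of C (c *\<^sub>R x) \<le> \<bar>c\<bar> * gauge_of C x" if "c \<noteq> 0" for c x
  proof (rule field_le_epsilon)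
    fix e :: real assume e: "0 < e"
    define t where "t = gauge_of C x + e / \<bar>c\<bar>"
    have t: "0 < t" using e that gauge_of_nonneg[of x] by (simp add: t_def add_nonneg_pos)
    have "gauge_of C x \<le> t" using e that by (simp add: t_def)
    then have *: "x /\<^sub>R t \<in> C" using t by (simp add: gauge_of_le_iff)
    have "(c *\<^sub>R x) /\<^sub>R (\<bar>c\<bar> * t) = sgn c *\<^sub>R (x /\<^sub>R t)"
      using that by (simp add: sgn_if field_simps)
    also have "\<dots> \<in> C" using * sym that by (auto simp: sgn_if)
    finally have "gauge_of C (c *\<^sub>R x) \<le> \<bar>c\<bar> * t"
      using t that by (subst gauge_of_le_iff) auto
    also have "\<dots> = \<bar>c\<bar> * gauge_of C x + e" using that by (simp add: t_def field_simps)
    finally show "gauge_of C (c *\<^sub>R x) \<le> \<bar>c\<bar> * gauge_of C x + e" .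
  qed
  show ?thesis
  proof (cases "c = 0")
    case True
    then show ?thesis
      using gauge_of_bounds[of 0] is_normD(5)[OF is_norm_p] by simp
  next
    case False
    have "gauge_of C x \<le> \<bar>inverse c\<bar> * gauge_of C (c *\<^sub>R x)"
      using le[of "inverse c" "c *\<^sub>R x"] False by simp
    then show ?thesis using le[OF False, of x] False by (simp add: field_simps)
  qed
qed

lemma gauge_of_triangle: "gauge_of C (x + y) \<le> gauge_of C x + gauge_of C y"
proof (rule field_le_epsilon)
  fix e :: real assume e: "0 < e"
  define s where "s = gauge_of C x + e / 2"
  define t where "t = gauge_of C y + e / 2"
  have st: "0 < s" "0 < t"
    using e gauge_of_nonneg[of x] gauge_of_nonneg[of y] by (auto simp: s_def t_def)
  have "x /\<^sub>R s \<in> C" "y /\<^sub>R t \<in> C"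
    using st e by (auto simp: gauge_of_le_iff[symmetric] s_def t_def)
  then obtain z where z: "z \<in> C" "s *\<^sub>R (x /\<^sub>R s) + t *\<^sub>R (y /\<^sub>R t) = (s + t) *\<^sub>R z"
    using convex_combine_multiples[OF C(2)] st by (metis less_imp_le)
  then have "(x + y) /\<^sub>R (s + t) = z" using st by simp
  then have "gauge_of C (x + y) \<le> s + t"
    using z(1) st by (subst gauge_of_le_iff) auto
  then show "gauge_of C (x + y) \<le> gauge_of C x + gauge_of C y + e"
    by (simp add: s_def t_def)
qed

lemma gauge_of_equiv_norm: "gauge_of C \<in> equiv_norms"
proof -
  have "gauge_of C x = 0 \<longleftrightarrow> x = 0" for x
    using gauge_of_bounds[of x] is_normD(1,2)[OF is_norm_p, of x] r
    by (metis divide_eq_0_iff order_antisym gauge_of_nonneg)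
  then have "is_norm (gauge_of C)"
    unfolding is_norm_def using gauge_of_nonneg gauge_of_scaleR gauge_of_triangle by auto
  moreover obtain a b where ab: "0 < a" "0 < b" "\<And>x. a * norm x \<le> p x" "\<And>x. p x \<le> b * norm x"
    using p by (auto simp: equiv_norms_def)
  have "a * norm x \<le> gauge_of C x" for x
    using ab(3) gauge_of_bounds(1) by (rule order_trans)
  moreover have "gauge_of C x \<le> (b / r) * norm x" for x
  proof -
    have "p x / r \<le> b * norm x / r" using ab(4) r by (intro divide_right_mono) auto
    then show ?thesis using gauge_of_bounds(2)[of x] by simp
  qed
  moreover have "0 < b / r" using ab(2) r by simp
  ultimately show ?thesis
    unfolding equiv_norms_def using ab(1) by blast
qed

lemma gauge_of_unit_ball: "{x. gauge_of C x \<le> 1} = C"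
  using gauge_of_le_iff[of 1] by auto

end

section \<open>Polytopal approximation of a norm\<close>

lemma finite_net_of_norm_sphere:
  fixes p :: "'a::real_normed_vector \<Rightarrow> real"
  assumes fd: "\<exists>B :: 'a set. finite B \<and> span B = UNIV"
    and p: "p \<in> equiv_norms" and \<delta>: "0 < \<delta>"
  obtains F where "finite F" "F = uminus ` F" "F \<subseteq> {x. p x = 1}"
    "\<And>x. p x = 1 \<Longrightarrow> \<exists>f\<in>F. p (x - f) \<le> \<delta>"
proof -
  let ?S = "{x. p x = 1}"
  have is_norm_p: "is_norm p" using p by (simp add: equiv_norms_def)
  obtain a b where ab: "0 < a" "0 < b" "\<And>x. a * norm x \<le> p x" "\<And>x. p x \<le> b * norm x"
    using p by (auto simp: equiv_norms_def)
  have "closed ?S"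
    using continuous_closed_vimage[of "{1}" p] equiv_norms_continuous[OF p]
    by (simp add: vimage_def continuous_on_eq_continuous_at)
  moreover have "compact (cball 0 (1 / a) :: 'a set)"
    using fd compact_cball_Int_span by (metis Int_UNIV_right)
  moreover have "?S = cball 0 (1 / a) \<inter> ?S"
  proof -
    have "norm x \<le> 1 / a" if "p x = 1" for x
      using ab(3)[of x] ab(1) that by (simp add: field_simps)
    then show ?thesis by auto
  qed
  ultimately have "compact ?S" by (metis compact_Int_closed)
  moreover have "?S \<subseteq> (\<Union>x\<in>?S. ball x (\<delta> / b))"
  proof
    fix x assume "x \<in> ?S"
    moreover have "x \<in> ball x (\<delta> / b)" using \<delta> ab(2) by simp
    ultimately show "x \<in> (\<Union>x\<in>?S. ball x (\<delta> / b))" by (rule UN_I)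
  qed
  ultimately obtain k where k: "k \<subseteq> ?S" "finite k" "?S \<subseteq> (\<Union>x\<in>k. ball x (\<delta> / b))"
    using compactE_image[of ?S ?S "\<lambda>x. ball x (\<delta> / b)"] open_ball by metis
  show thesis
  proof
    show "finite (k \<union> uminus ` k)" using k(2) by simp
    show "k \<union> uminus ` k = uminus ` (k \<union> uminus ` k)" by (auto simp: image_Un image_image)
    show "k \<union> uminus ` k \<subseteq> ?S" using k(1) by (auto simp: is_normD(6)[OF is_norm_p])
    fix x assume "p x = 1"
    then obtain f where f: "f \<in> k" "dist f x < \<delta> / b" using k(3) by auto
    have "p (x - f) \<le> b * norm (x - f)" by (rule ab(4))
    also have "\<dots> \<le> \<delta>" using f(2) ab(2) by (simp add: dist_norm norm_minus_commute field_simps)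
    finally show "\<exists>f\<in>k \<union> uminus ` k. p (x - f) \<le> \<delta>" using f(1) by blast
  qed
qed

text \<open>
  If \<open>R\<close> bounds the norms of the points of \<open>F\<close>, then each \<open>f / R\<close> lies between 0 and the
  normalized point, so the convex hull of the normalized points contains the hull of \<open>F\<close> shrunk
  by the factor \<open>R\<close>, and with it a ball.
\<close>

lemma direction_set_normalized:
  fixes F :: "'a::real_normed_vector set"
  assumes F: "finite F" "F = uminus ` F" "0 \<notin> F"
    and ball: "0 < s" "ball 0 s \<subseteq> convex hull F"
  shows "direction_set ((\<lambda>x. x /\<^sub>R norm x) ` F)" (is "direction_set ?E")
proof -
  obtain R where R: "0 < R" "\<And>f. f \<in> F \<Longrightarrow> norm f \<le> R"
    using finite_imp_bounded[OF F(1)] by (auto simp: bounded_pos)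
  have hull0: "0 \<in> convex hull ?E"
  proof -
    have "0 \<in> convex hull F" using ball by auto
    then obtain f where f: "f \<in> F" by (metis convex_hull_empty empty_iff equals0I)
    then have "- f \<in> F" using F(2) by blast
    then have "f /\<^sub>R norm f \<in> ?E" "- (f /\<^sub>R norm f) \<in> ?E" using f by force+
    then have "(1/2) *\<^sub>R (f /\<^sub>R norm f) + (1/2) *\<^sub>R (- (f /\<^sub>R norm f)) \<in> convex hull ?E"
      by (intro convexD[OF convex_convex_hull] hull_inc) auto
    then show ?thesis by simp
  qed
  have "(*\<^sub>R) (1 / R) ` F \<subseteq> convex hull ?E"
  proof clarify
    fix f assume f: "f \<in> F"
    have "(norm f / R) *\<^sub>R (f /\<^sub>R norm f) + (1 - norm f / R) *\<^sub>R 0 \<in> convex hull ?E"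
      using R f by (intro convexD[OF convex_convex_hull] hull0 hull_inc) auto
    moreover have "f \<noteq> 0" using f F(3) by blast
    ultimately show "(1 / R) *\<^sub>R f \<in> convex hull ?E" by simp
  qed
  then have "convex hull ((*\<^sub>R) (1 / R) ` F) \<subseteq> convex hull ?E"
    by (simp add: hull_minimal)
  then have sub: "(*\<^sub>R) (1 / R) ` (convex hull F) \<subseteq> convex hull ?E"
    by (simp only: convex_hull_scaling)
  have "ball 0 (s / R) \<subseteq> convex hull ?E"
  proof
    fix x :: 'a assume "x \<in> ball 0 (s / R)"
    then have "R *\<^sub>R x \<in> ball 0 s" using R(1) by (simp add: field_simps)
    then have "(1 / R) *\<^sub>R (R *\<^sub>R x) \<in> convex hull ?E" using ball(2) sub by blast
    then show "x \<in> convex hull ?E" using R(1) by simp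
  qed
  moreover have "0 \<in> ball (0::'a) (s / R)" using ball(1) R(1) by simp
  ultimately have "interior (convex hull ?E) \<noteq> {}"
    using interior_maximal open_ball by blast
  moreover have "uminus ` ?E = (\<lambda>x. x /\<^sub>R norm x) ` uminus ` F"
    by (simp add: image_image)
  then have "?E = uminus ` ?E" using F(2) by simp
  moreover have "?E \<subseteq> sphere 0 1" 
  proof clarify
    fix f assume "f \<in> F"
    then have "f \<noteq> 0" using F(3) by blast
    then show "f /\<^sub>R norm f \<in> sphere 0 1" by simp
  qed
  ultimately show ?thesis
    unfolding direction_set_def using F(1) by blast
qed

text \<open>
  The norm \<open>q\<close> is the gauge of the convex hull of a finite symmetric \<open>\<delta>\<close>-net \<open>F\<close> of the unit sphere
  of \<open>p\<close>, and \<open>E\<close> consists of the directions of the points of \<open>F\<close>. Taking the net in the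
  sphere rather than in the ball keeps 0 out of \<open>F\<close>.
\<close>

lemma approx_by_dir_norm:
  fixes p :: "'a::real_normed_vector \<Rightarrow> real"
  assumes fd: "\<exists>B :: 'a set. finite B \<and> span B = UNIV" and nz: "\<exists>x :: 'a. x \<noteq> 0"
    and p: "p \<in> equiv_norms" and \<delta>: "0 < \<delta>" "\<delta> < 1"
  obtains E q where "direction_set E" "q \<in> dir_norms E"
    "\<And>x. p x \<le> q x" "\<And>x. q x \<le> p x / (1 - \<delta>)"
proof -
  have is_norm_p: "is_norm p" using p by (simp add: equiv_norms_def)
  obtain F where F: "finite F" "F = uminus ` F" "F \<subseteq> {x. p x = 1}"
    and net: "\<And>x. p x = 1 \<Longrightarrow> \<exists>f\<in>F. p (x - f) \<le> \<delta>"
    using finite_net_of_norm_sphere[OF fd p \<delta>(1)] by metis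
  define C where "C = convex hull F"
  have unit: "p (x /\<^sub>R p x) = 1" if "x \<noteq> 0" for x
    using that is_normD(1,2)[OF is_norm_p, of x] by (simp add: is_normD(3)[OF is_norm_p])
  obtain f0 where f0: "f0 \<in> F" using nz unit net by blast
  have closed: "closed C"
    unfolding C_def using F(1) by (intro compact_imp_closed finite_imp_compact_convex_hull)
  have conv: "convex C" by (simp add: C_def)
  have sym: "C = uminus ` C"
    using F(2) convex_hull_linear_image[of uminus F] by (simp add: C_def linear_uminus)
  have outer: "C \<subseteq> {x. p x \<le> 1}"
    unfolding C_def
  proof (rule hull_minimal)
    show "F \<subseteq> {x. p x \<le> 1}" using F(3) by auto
    show "convex {x. p x \<le> 1}"
    proof (rule convexI, clarify)
      fix x y and u v :: real
      assume "p x \<le> 1" "p y \<le> 1" "0 \<le> u" "0 \<le> v" and uv: "u + v = 1"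
      then have "u * p x + v * p y \<le> 1" by (intro convex_bound_le) auto
      then show "p (u *\<^sub>R x + v *\<^sub>R y) \<le> 1"
        using is_normD(4)[OF is_norm_p, of "u *\<^sub>R x" "v *\<^sub>R y"] \<open>0 \<le> u\<close> \<open>0 \<le> v\<close>
        by (simp add: is_normD(3)[OF is_norm_p])
    qed
  qed
  have zero: "0 \<in> C"
  proof -
    have "f0 \<in> C" "- f0 \<in> C" using f0 F(2) by (auto simp: C_def intro!: hull_inc)
    from convexD[OF conv this, of "1/2" "1/2"] show ?thesis by simp
  qed
  have approx: "\<exists>c\<in>C. p (x - p x *\<^sub>R c) \<le> \<delta> * p x" for x
  proof (cases "x = 0")
    case True
    then show ?thesis using zero is_normD(5)[OF is_norm_p] by (intro bexI[of _ 0]) auto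
  next
    case False
    obtain f where f: "f \<in> F" "p (x /\<^sub>R p x - f) \<le> \<delta>" using net[OF unit[OF False]] by blast
    have px: "0 < p x" using equiv_norms_pos[OF p False] .
    have "x - p x *\<^sub>R f = p x *\<^sub>R (x /\<^sub>R p x - f)" using px by (simp add: scaleR_right_diff_distrib)
    then have "p (x - p x *\<^sub>R f) = p x * p (x /\<^sub>R p x - f)" using px by (simp add: is_normD(3)[OF is_norm_p])
    also have "\<dots> \<le> p x * \<delta>" using f(2) px by (intro mult_left_mono) auto
    finally show ?thesis using f(1) unfolding C_def by (metis hull_inc mult.commute)
  qed
  have inner: "{x. p x \<le> 1 - \<delta>} \<subseteq> C"
    using norm_ball_subset_if_approximated[OF p closed conv zero _ \<delta>(2) approx] \<delta> by auto
  interpret norm_body C p "1 - \<delta>"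
    using p closed conv sym inner outer \<delta> by unfold_locales auto
  have F0: "0 \<notin> F" using F(3) is_normD(5)[OF is_norm_p] by auto
  obtain b where b: "0 < b" "\<And>x. p x \<le> b * norm x" using p by (auto simp: equiv_norms_def)
  have "ball 0 ((1 - \<delta>) / b) \<subseteq> C"
  proof
    fix x :: 'a assume "x \<in> ball 0 ((1 - \<delta>) / b)"
    then have "b * norm x < 1 - \<delta>" using b(1) by (simp add: field_simps)
    then show "x \<in> C" using inner b(2)[of x] by force
  qed
  then have E: "direction_set ((\<lambda>x. x /\<^sub>R norm x) ` F)"
    using direction_set_normalized[OF F(1,2) F0, of "(1 - \<delta>) / b"] \<delta>(2) b(1) by (simp add: C_def)
  have extreme: "gauge_of C \<in> dir_norms ((\<lambda>x. x /\<^sub>R norm x) ` F)"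
    unfolding dir_norms_def
  proof (clarsimp simp: gauge_of_equiv_norm gauge_of_unit_ball)
    fix x assume "x extreme_point_of C"
    then have x: "x \<in> F" unfolding C_def by (rule extreme_point_of_convex_hull)
    then have "x \<noteq> 0" using F0 by blast
    then have "x = norm x *\<^sub>R (x /\<^sub>R norm x)" "0 < norm x" by auto
    then show "x \<in> Dir ((\<lambda>x. x /\<^sub>R norm x) ` F)" using x unfolding Dir_def by blast
  qed
  show thesis
  proof (rule that)
    show "direction_set ((\<lambda>x. x /\<^sub>R norm x) ` F)" by (rule E)
    show "gauge_of C \<in> dir_norms ((\<lambda>x. x /\<^sub>R norm x) ` F)" by (rule extreme)
    show "p x \<le> gauge_of C x" "gauge_of C x \<le> p x / (1 - \<delta>)" for x
      by (rule gauge_of_bounds)+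
  qed
qed

section \<open>Density\<close>

theorem theorem6p5:
  assumes "\<exists>B :: 'a::banach set. finite B \<and> span B = UNIV"
    and "\<exists>x :: 'a. x \<noteq> 0"
  shows "Metric_space.mtopology norm_classes class_dist closure_of
           (\<Union>E \<in> {E :: 'a set. direction_set E}. dir_norm_classes E) = norm_classes"
proof -
  obtain e :: 'a where e: "e \<noteq> 0" using assms(2) by blast
  interpret Metric_space "norm_classes :: ('a \<Rightarrow> real) set set" class_dist
    using e by (rule Metric_space_class_dist)
  have "\<exists>Q \<in> (\<Union>E \<in> {E :: 'a set. direction_set E}. dir_norm_classes E). Q \<in> mball P \<epsilon>"
    if P: "P \<in> norm_classes" and \<epsilon>: "0 < \<epsilon>" for P :: "('a \<Rightarrow> real) set" and \<epsilon>
  proof -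
    obtain p where p: "p \<in> equiv_norms" "P = norm_sim `` {p}"
      using P by (auto simp: norm_classes_def elim!: quotientE)
    \<comment> \<open>This makes the ratio \<open>1 / (1 - \<delta>)\<close> of the two bounds equal to \<open>exp (\<epsilon> / 2)\<close>.\<close>
    define \<delta> where "\<delta> = 1 - exp (- (\<epsilon> / 2))"
    have \<delta>: "0 < \<delta>" "\<delta> < 1" using \<epsilon> by (auto simp: \<delta>_def)
    obtain E q where E: "direction_set E" and q: "q \<in> dir_norms E"
      and pq: "\<And>x. p x \<le> q x" "\<And>x. q x \<le> p x / (1 - \<delta>)"
      using approx_by_dir_norm[OF assms p(1) \<delta>] by metis
    have qe: "q \<in> equiv_norms" using q by (simp add: dir_norms_def)
    define Q where "Q = norm_sim `` {q}"
    have Q: "Q \<in> dir_norm_classes E"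
      unfolding Q_def dir_norm_classes_def using q by (rule quotientI)
    have "upper_const p q \<le> exp (\<epsilon> / 2)"
      using pq(2) by (intro upper_const_le[OF e p(1) qe]) (simp add: \<delta>_def exp_minus field_simps)
    moreover have "upper_const q p \<le> 1"
      using pq(1) by (intro upper_const_le[OF e qe p(1)]) simp
    ultimately have "upper_const p q * upper_const q p \<le> exp (\<epsilon> / 2) * 1"
      using upper_const_pos[OF e qe p(1)] by (intro mult_mono) auto
    then have "norm_dist p q \<le> ln (exp (\<epsilon> / 2))"
      unfolding norm_dist_eq[OF e p(1) qe]
      using upper_const_pos[OF e qe p(1)] upper_const_pos[OF e p(1) qe]
      by (subst ln_le_cancel_iff) auto
    also have "\<dots> < \<epsilon>" using \<epsilon> by simp
    finally have "class_dist P Q < \<epsilon>"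
      unfolding p(2) Q_def using class_dist_class[OF e p(1) qe] by simp
    moreover have "Q \<in> norm_classes" using Q dir_norm_classes_subset by blast
    ultimately show ?thesis using P Q E by auto
  qed
  then show ?thesis unfolding metric_closure_of by blast
qed

end
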